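(* Let $\Sigma$ be an alphabet of size $k$. Any partial word over $\Sigma$ in which exactly one position starts a square contains at most $k$ squares. Furthermore, for every $k$ there exists a partial word over an alphabet of size $k$ in which exactly one position starts a square and which contains exactly $k$ squares.
   Context: Let $\diamond \notin \Sigma$ be a hole symbol. A partial word over $\Sigma$ is a finite sequence over $\Sigma \cup \{\diamond\}$; a full word is one with no holes. Positions are indexed from $1$; $w[i..j]$ is the factor occupying positions $i$ to $j$, said to start at position $i$; a partial word contains a square if one of its factors is a square, and a position starts a square if some factor starting at that position is a square. For partial words $u, v$ of equal length, $u \subset v$ means that every non-hole position of $u$ is a non-hole position of $v$ carrying the same letter. A partial word $u$ is a square if $u \subset xx$ for some nonempty full word $x$. *)

theory Defs
  imports Main
begin

text \<open>A partial word is a list over \<open>'a option\<close>; \<open>None\<close> is the hole.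
  Positions are counted from 1, as in \<open>w[i..j]\<close>.\<close>

type_synonym 'a pword = "'a option list"

definition partial_word :: "'a set \<Rightarrow> 'a pword \<Rightarrow> bool" where
  "partial_word \<Sigma> w \<longleftrightarrow> set w \<subseteq> insert None (Some ` \<Sigma>)"

definition full_word :: "'a set \<Rightarrow> 'a pword \<Rightarrow> bool" where
  "full_word \<Sigma> w \<longleftrightarrow> partial_word \<Sigma> w \<and> None \<notin> set w"

definition contained :: "'a pword \<Rightarrow> 'a pword \<Rightarrow> bool" where
  "contained u v \<longleftrightarrow>
     length u = length v \<and> (\<forall>i<length u. u ! i \<noteq> None \<longrightarrow> v ! i \<noteq> None \<and> v ! i = u ! i)"

definition is_square :: "'a set \<Rightarrow> 'a pword \<Rightarrow> bool" where
  "is_square \<Sigma> u \<longleftrightarrow> (\<exists>x. full_word \<Sigma> x \<and> x \<noteq> [] \<and> contained u (x @ x))"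

text \<open>\<open>factor w i j\<close> is \<open>w[i..j]\<close>; it is only meaningful for \<open>1 \<le> i \<le> j \<le> length w\<close>.\<close>

definition factor :: "'a pword \<Rightarrow> nat \<Rightarrow> nat \<Rightarrow> 'a pword" where
  "factor w i j = take (j + 1 - i) (drop (i - 1) w)"

text \<open>Squares in a word are counted as occurrences, i.e. as pairs \<open>(i, j)\<close> such that
  \<open>w[i..j]\<close> is a square. When only one position starts a square, distinct occurrences have
  distinct lengths, so this is also the number of distinct factors that are squares.\<close>

definition squares :: "'a set \<Rightarrow> 'a pword \<Rightarrow> (nat \<times> nat) set" where
  "squares \<Sigma> w =
     {(i, j). 1 \<le> i \<and> i \<le> j \<and> j \<le> length w \<and> is_square \<Sigma> (factor w i j)}"

definition starts_square :: "'a set \<Rightarrow> 'a pword \<Rightarrow> nat \<Rightarrow> bool" where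
  "starts_square \<Sigma> w i \<longleftrightarrow> (\<exists>j. (i, j) \<in> squares \<Sigma> w)"

lemma finite_squares: "finite (squares \<Sigma> w)"
  by (rule finite_subset[of _ "{..length w} \<times> {..length w}"]) (auto simp: squares_def)

end

theory Submission
  imports Defs "HOL-Computational_Algebra.Euclidean_Algorithm"
begin

text \<open>A hole is compatible with its neighbours, so if only one position starts a square, a hole
  is either the first letter or, in the degenerate case of a single square of length 2, the last
  one. Otherwise sending a square of period \<open>p\<close> starting at \<open>s\<close> to the letter \<open>w ! (s + p)\<close> is
  injective: two squares with the same letter would become two prefixes \<open>xx\<close>, \<open>yy\<close> of a full word
  after filling the hole, and comparing lengths yields another square further to the right.

  For the lower bound, put a hole in front of the square-free Zimin word, whose \<open>n\<close>-th letter is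
  the 2-adic valuation of \<open>n\<close>; every power of two then is the period of a prefix square.\<close>

section \<open>Squares described by a start and a period\<close>

definition compatible :: "'a option \<Rightarrow> 'a option \<Rightarrow> bool" where
  "compatible a b \<longleftrightarrow> a = None \<or> b = None \<or> a = b"

text \<open>Here the start \<open>s\<close> is counted from 0.\<close>

definition square_at :: "'a pword \<Rightarrow> nat \<Rightarrow> nat \<Rightarrow> bool" where
  "square_at w s p \<longleftrightarrow>
     0 < p \<and> s + 2 * p \<le> length w \<and> (\<forall>t<p. compatible (w ! (s + t)) (w ! (s + p + t)))"

lemma square_atI:
  assumes "0 < p" "s + 2 * p \<le> length w"
    and "\<And>t. t < p \<Longrightarrow> compatible (w ! (s + t)) (w ! (s + p + t))"
  shows "square_at w s p"
  using assms by (simp add: square_at_def)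

text \<open>Compatible halves fill each other's holes, which yields the root \<open>x\<close>. An
  offset at which both halves have a hole takes an arbitrary letter, supplied by
  \<open>ne\<close>.\<close>

lemma is_square_iff_square_at:
  assumes u: "partial_word \<Sigma> u" and ne: "\<Sigma> \<noteq> {}"
  shows "is_square \<Sigma> u \<longleftrightarrow> (\<exists>p. length u = 2 * p \<and> square_at u 0 p)"
proof
  assume "is_square \<Sigma> u"
  then obtain x where x: "full_word \<Sigma> x" "x \<noteq> []" and c: "contained u (x @ x)"
    by (auto simp: is_square_def)
  have len: "length u = 2 * length x"
    using c by (simp add: contained_def)
  have "square_at u 0 (length x)"
  proof (rule square_atI)
    fix t assume t: "t < length x"
    have *: "u ! i \<noteq> None \<longrightarrow> (x @ x) ! i = u ! i" if "i < length u" for i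
      using c that by (simp add: contained_def)
    show "compatible (u ! (0 + t)) (u ! (0 + length x + t))"
      using *[of t] *[of "length x + t"] t len
      by (auto simp: compatible_def nth_append simp del: not_None_eq)
  qed (use x len in auto)
  then show "\<exists>p. length u = 2 * p \<and> square_at u 0 p"
    using len by blast
next
  assume "\<exists>p. length u = 2 * p \<and> square_at u 0 p"
  then obtain p where len: "length u = 2 * p" and sq: "square_at u 0 p" by blast
  obtain a where a: "a \<in> \<Sigma>" using ne by blast
  define f where "f t = (if u ! t \<noteq> None then u ! t
    else if u ! (p + t) \<noteq> None then u ! (p + t) else Some a)" for t
  define x where "x = map f [0..<p]"
  have in_u: "u ! i \<in> insert None (Some ` \<Sigma>)" if "i < 2 * p" for i
    using u nth_mem[of i u] that len unfolding partial_word_def by fastforce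
  have f: "f t \<in> Some ` \<Sigma>" if "t < p" for t
    using in_u[of t] in_u[of "p + t"] that a by (auto simp: f_def)
  then have "full_word \<Sigma> x"
    by (fastforce simp: full_word_def partial_word_def x_def)
  moreover have "x \<noteq> []"
    using sq by (auto simp: x_def square_at_def)
  moreover have "contained u (x @ x)"
    unfolding contained_def
  proof (intro conjI allI impI)
    show "length u = length (x @ x)" using len by (simp add: x_def)
    fix i assume i: "i < length u" and nn: "u ! i \<noteq> None"
    have "(x @ x) ! i = u ! i"
    proof (cases "i < p")
      case True
      then show ?thesis using nn by (simp add: x_def nth_append f_def)
    next
      case False
      then obtain t where t: "i = p + t" using le_Suc_ex not_less by blast
      then have "t < p" using i len by simp
      then have "compatible (u ! t) (u ! (p + t))" using sq by (simp add: square_at_def)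
      then show ?thesis using t \<open>t < p\<close> nn by (auto simp: x_def nth_append f_def compatible_def)
    qed
    then show "(x @ x) ! i \<noteq> None" "(x @ x) ! i = u ! i" using nn by auto
  qed
  ultimately show "is_square \<Sigma> u" by (auto simp: is_square_def)
qed

lemma square_at_factor:
  assumes "length (factor w (Suc s) j) = 2 * p" "j \<le> length w"
  shows "square_at (factor w (Suc s) j) 0 p \<longleftrightarrow> 0 < p \<and> j = s + 2 * p \<and> square_at w s p"
proof -
  have "j - s = 2 * p" using assms by (auto simp: factor_def)
  then show ?thesis using assms(2)
    by (auto simp: square_at_def factor_def add.assoc)
qed

text \<open>Reduces counting factors to counting periods. A start \<open>s\<close> counted from 0 is
  position \<open>Suc s\<close>, so length \<open>2 * p\<close> ends at position
  \<open>s + 2 * p\<close>.\<close>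

lemma squares_eq:
  assumes w: "partial_word \<Sigma> w" and ne: "\<Sigma> \<noteq> {}"
  shows "squares \<Sigma> w = {(Suc s, s + 2 * p) |s p. square_at w s p}"
proof -
  have "(Suc s, j) \<in> squares \<Sigma> w \<longleftrightarrow> (\<exists>p. j = s + 2 * p \<and> square_at w s p)" for s j
  proof -
    have "partial_word \<Sigma> (factor w (Suc s) j)"
      using w set_take_subset set_drop_subset
      unfolding partial_word_def factor_def by (meson subset_trans)
    note iff = is_square_iff_square_at[OF this ne]
    show ?thesis
    proof (cases "Suc s \<le> j \<and> j \<le> length w")
      case True
      then have "length (factor w (Suc s) j) = j - s" by (auto simp: factor_def)
      then show ?thesis
        using True iff square_at_factor[of w s j]
        by (auto simp: squares_def square_at_def)
    next
      case False
      then show ?thesis by (auto simp: squares_def square_at_def)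
    qed
  qed
  moreover have "(0, j) \<notin> squares \<Sigma> w" for j by (simp add: squares_def)
  ultimately show ?thesis
    apply (auto)
     apply (metis not0_implies_Suc)
    done
qed

lemma starts_square_iff:
  assumes "partial_word \<Sigma> w" "\<Sigma> \<noteq> {}"
  shows "starts_square \<Sigma> w i \<longleftrightarrow> (\<exists>s p. i = Suc s \<and> square_at w s p)"
  by (auto simp: starts_square_def squares_eq[OF assms])

section \<open>Upper bound: squares with a common start\<close>

lemma square_at_hole:
  assumes "s + 1 < length w" "w ! s = None \<or> w ! (s + 1) = None"
  shows "square_at w s 1"
  using assms by (intro square_atI) (auto simp: compatible_def)

text \<open>Both right halves repeat what follows \<open>s\<close>, so the letters from
  \<open>s + p\<close> and from \<open>s + q\<close> agree for \<open>p\<close> steps. Offset 0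
  needs \<open>eq\<close>, because \<open>w ! s\<close> may be a hole.\<close>

lemma two_squares_imp_later_square:
  assumes p: "square_at w s p" and q: "square_at w s q" and pq: "p < q"
    and full: "\<And>t. s < t \<Longrightarrow> t < length w \<Longrightarrow> w ! t \<noteq> None"
    and eq: "w ! (s + p) = w ! (s + q)"
  shows "\<exists>s'>s. \<exists>p'. square_at w s' p'"
proof -
  \<comment> \<open>As \<open>0 < t\<close>, both positions lie beyond \<open>s\<close>, so
    \<open>full\<close> turns compatibility into equality.\<close>
  have shift: "w ! (s + r + t) = w ! (s + t)" if "square_at w s r" "0 < t" "t < r" for r t
    using that full[of "s + t"] full[of "s + r + t"] by (auto simp: square_at_def compatible_def)
  have p0: "0 < p" and len: "s + 2 * q \<le> length w"
    using p q by (auto simp: square_at_def)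
  show ?thesis
  proof (cases "q \<le> 2 * p")
    case True
    \<comment> \<open>The block of length \<open>q - p\<close> at \<open>s + p\<close> is followed
      at once by its copy at \<open>s + q\<close>; \<open>q - p \<le> p\<close> keeps it inside the
      shorter square.\<close>
    have "square_at w (s + p) (q - p)"
    proof (rule square_atI)
      fix t assume t: "t < q - p"
      have "w ! (s + p + t) = w ! (s + q + t)"
        using shift[OF p, of t] shift[OF q, of t] t True eq by (cases "t = 0") auto
      then show "compatible (w ! (s + p + t)) (w ! (s + p + (q - p) + t))"
        using pq by (simp add: compatible_def)
    qed (use pq len in auto)
    then show ?thesis using p0 by (meson less_add_same_cancel1)
  next
    case False
    \<comment> \<open>The shorter square fits into the left half of the longer one, so it recurs in
      the right half.\<close>
    have "square_at w (s + q) p"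
    proof (rule square_atI)
      fix t assume t: "t < p"
      have "w ! (s + q + (p + t)) = w ! (s + (p + t))"
        using shift[OF q, of "p + t"] t p0 False by simp
      also have "\<dots> = w ! (s + q + t)"
        using shift[OF p, of t] shift[OF q, of t] t pq eq by (cases "t = 0") (auto simp: add.assoc)
      finally show "compatible (w ! (s + q + t)) (w ! (s + q + p + t))"
        by (simp add: compatible_def add.assoc)
    qed (use p0 False len in auto)
    then show ?thesis using pq by (meson less_add_same_cancel1 less_trans p0)
  qed
qed

lemma card_squares_le:
  assumes fin: "finite \<Sigma>" and w: "partial_word \<Sigma> w" and ex1: "\<exists>!i. starts_square \<Sigma> w i"
  shows "card (squares \<Sigma> w) \<le> card \<Sigma>"
proof -
  \<comment> \<open>The root of the given square supplies a letter.\<close>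
  have ne: "\<Sigma> \<noteq> {}"
  proof -
    obtain x where "full_word \<Sigma> x" "x \<noteq> []"
      using ex1 unfolding starts_square_def squares_def is_square_def by blast
    then show ?thesis by (cases x) (auto simp: full_word_def partial_word_def)
  qed
  note starts = starts_square_iff[OF w ne]
  obtain s where s: "\<And>s' p. square_at w s' p \<Longrightarrow> s' = s"
    using ex1 unfolding starts by blast
  define P where "P = {p. square_at w s p}"
  have sq: "squares \<Sigma> w = (\<lambda>p. (Suc s, s + 2 * p)) ` P"
    unfolding squares_eq[OF w ne] P_def by (auto dest: s)
  have card: "card (squares \<Sigma> w) = card P"
    unfolding sq by (rule card_image) (auto simp: inj_on_def)
  show ?thesis
  proof (cases "\<exists>t. s < t \<and> t < length w \<and> w ! t = None")
    case True
    then obtain t where t: "s < t" "t < length w" "w ! t = None" by blast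
    \<comment> \<open>The hole forms a square of period 1 with any neighbour: its left one must be
      \<open>s\<close>, and a right one would make \<open>t\<close> a second start. Hence only
      period 1 fits.\<close>
    have "t - 1 = s"
      using t by (intro s[of _ 1] square_at_hole) auto
    moreover have "\<not> t + 1 < length w"
      using s[of t 1] square_at_hole[of t w] t by auto
    ultimately have "length w = s + 2" using t by auto
    then have "P \<subseteq> {1}" by (auto simp: P_def square_at_def)
    then have "card P \<le> 1" using card_mono[of "{1::nat}" P] by simp
    also have "1 \<le> card \<Sigma>" using fin ne by (simp add: Suc_le_eq card_gt_0_iff)
    finally show ?thesis using card by simp
  next
    case False
    then have full: "\<And>t. s < t \<Longrightarrow> t < length w \<Longrightarrow> w ! t \<noteq> None" by metis
    have "inj_on (\<lambda>p. w ! (s + p)) P"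
    proof (rule linorder_inj_onI)
      fix p q assume pq: "p < q" "p \<in> P" "q \<in> P"
      show "w ! (s + p) \<noteq> w ! (s + q)"
      proof
        assume "w ! (s + p) = w ! (s + q)"
        then obtain s' p' where "s < s'" "square_at w s' p'"
          using two_squares_imp_later_square[of w s p q] full pq unfolding P_def by blast
        then show False using s[of s' p'] by simp
      qed
    qed auto
    moreover have "(\<lambda>p. w ! (s + p)) ` P \<subseteq> Some ` \<Sigma>"
    proof clarify
      fix p assume "p \<in> P"
      then have "s < s + p" "s + p < length w" by (auto simp: P_def square_at_def)
      then show "w ! (s + p) \<in> Some ` \<Sigma>"
        using full[of "s + p"] w by (auto simp: partial_word_def dest!: nth_mem)
    qed
    ultimately have "card P \<le> card (Some ` \<Sigma>)"
      using fin by (intro card_inj_on_le) auto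
    also have "\<dots> \<le> card \<Sigma>" using fin by (rule card_image_le)
    finally show ?thesis using card by simp
  qed
qed

section \<open>Lower bound: the Zimin word behind a hole\<close>

text \<open>The hole sits at index 0, where the 2-adic valuation is infinite. For
  \<open>k \<ge> 1\<close>, length \<open>2 ^ k\<close> keeps the letters below \<open>k\<close> and
  just fits a square of period \<open>2 ^ (k - 1)\<close>.\<close>

definition hole_zimin :: "nat \<Rightarrow> nat pword" where
  "hole_zimin k = map (\<lambda>n. if n = 0 then None else Some (multiplicity 2 n)) [0..<2 ^ k]"

lemma power2_dvd_iff:
  fixes n :: nat
  assumes "0 < n"
  shows "2 ^ j dvd n \<longleftrightarrow> j \<le> multiplicity 2 n"
  using assms by (intro power_dvd_iff_le_multiplicity) auto

text \<open>With \<open>v = multiplicity 2 p\<close>, adding an odd multiple of \<open>2 ^ v\<close>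
  to a multiple of \<open>2 ^ v\<close> flips divisibility by \<open>2 ^ Suc v\<close>.\<close>

lemma multiplicity_two_add_neq:
  fixes n p :: nat
  assumes n: "0 < n" and p: "0 < p" and dvd: "2 ^ multiplicity 2 p dvd n"
  shows "multiplicity 2 (n + p) \<noteq> multiplicity 2 n"
proof
  define v where "v = multiplicity 2 p"
  assume eq: "multiplicity 2 (n + p) = multiplicity 2 n"
  obtain a where a: "p = 2 ^ v * a" using multiplicity_dvd[of 2 p] unfolding v_def by (rule dvdE)
  obtain b where b: "n = 2 ^ v * b" using dvd unfolding v_def by (rule dvdE)
  have suc: "2 ^ Suc v dvd 2 ^ v * c \<longleftrightarrow> even c" for c :: nat by simp
  have "\<not> 2 ^ Suc v dvd 2 ^ v * a"
    unfolding a[symmetric] power2_dvd_iff[OF p] by (simp add: v_def)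
  then have "odd a" unfolding suc .
  moreover have "2 ^ Suc v dvd n + p \<longleftrightarrow> 2 ^ Suc v dvd n"
    using power2_dvd_iff[OF n, of "Suc v"] power2_dvd_iff[of "n + p" "Suc v"] eq n by simp
  then have "even (b + a) \<longleftrightarrow> even b"
    unfolding a b distrib_left[symmetric] suc .
  ultimately show False by simp
qed

lemma ex_multiple_in_window:
  fixes d s p :: nat
  assumes "0 < d" "d \<le> p"
  shows "\<exists>t<p. d dvd s + t"
proof -
  show ?thesis
  proof (cases "d dvd s")
    case True
    then show ?thesis using assms by (intro exI[of _ 0]) auto
  next
    case False
    then have "0 < s mod d" by (simp add: dvd_eq_mod_eq_0)
    moreover have "s + (d - s mod d) = d * (s div d) + d"
      using assms mult_div_mod_eq[of d s] mod_less_divisor[of d s] by linarith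
    then have "d dvd s + (d - s mod d)" by simp
    \<comment> \<open>The witness is the distance from \<open>s\<close> to the next multiple of
      \<open>d\<close>.\<close>
    ultimately show ?thesis using assms by (intro exI[of _ "d - s mod d"]) auto
  qed
qed

text \<open>A left half of length \<open>p\<close> covers a multiple of the power of two in
  \<open>p\<close>; there the two letters differ, and \<open>s \<noteq> 0\<close> keeps the hole
  out.\<close>

lemma square_at_hole_zimin_start:
  assumes "square_at (hole_zimin k) s p"
  shows "s = 0"
proof (rule ccontr)
  assume s: "s \<noteq> 0"
  have p: "0 < p" and len: "s + 2 * p \<le> 2 ^ k"
    using assms by (auto simp: square_at_def hole_zimin_def)
  have "2 ^ multiplicity 2 p \<le> p"
    using p by (intro dvd_imp_le multiplicity_dvd)
  then obtain t where t: "t < p" "2 ^ multiplicity 2 p dvd s + t"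
    using ex_multiple_in_window[of "2 ^ multiplicity 2 p" p s] by auto
  have "multiplicity 2 (s + t + p) \<noteq> multiplicity 2 (s + t)"
    using s p t by (intro multiplicity_two_add_neq) auto
  moreover have "compatible (hole_zimin k ! (s + t)) (hole_zimin k ! (s + p + t))"
    using assms t by (simp add: square_at_def)
  ultimately show False
    using s p t len by (auto simp: compatible_def hole_zimin_def ac_simps)
qed

text \<open>For \<open>0 < t < 2 ^ j\<close> the valuation of \<open>t\<close> is below
  \<open>j\<close>, so adding \<open>2 ^ j\<close> preserves it; at \<open>t = 0\<close> the hole
  matches anything.\<close>

lemma square_at_hole_zimin:
  assumes "j < k"
  shows "square_at (hole_zimin k) 0 (2 ^ j)"
proof (rule square_atI)
  have le: "(2::nat) * 2 ^ j \<le> 2 ^ k"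
    using assms by (metis Suc_leI one_le_numeral power_Suc power_increasing)
  then show "0 + 2 * 2 ^ j \<le> length (hole_zimin k)" by (simp add: hole_zimin_def)
  fix t :: nat assume t: "t < 2 ^ j"
  have "multiplicity 2 (2 ^ j + t) = multiplicity 2 t" if "t \<noteq> 0"
  proof -
    have lt: "multiplicity 2 t < j"
    proof (rule ccontr)
      assume "\<not> multiplicity 2 t < j"
      then have "2 ^ j dvd t" using power2_dvd_iff[of t j] that by simp
      then show False using t that by (auto dest: dvd_imp_le)
    qed
    have iff: "2 ^ i dvd 2 ^ j + t \<longleftrightarrow> i \<le> multiplicity 2 t" if "i \<le> j" for i
      using that \<open>t \<noteq> 0\<close> power2_dvd_iff[of t i] by (simp add: dvd_add_right_iff le_imp_power_dvd)
    show ?thesis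
      \<comment> \<open>These two exponents pin down the valuation; \<open>lt\<close> keeps the
        larger one at most \<open>j\<close>.\<close>
      using iff[of "multiplicity 2 t"] iff[of "Suc (multiplicity 2 t)"] lt
      by (intro multiplicity_eqI) simp_all
  qed
  then show "compatible (hole_zimin k ! (0 + t)) (hole_zimin k ! (0 + 2 ^ j + t))"
    using t le by (auto simp: compatible_def hole_zimin_def)
qed simp

lemma partial_word_hole_zimin: "partial_word {..<k} (hole_zimin k)"
proof -
  have "multiplicity 2 n < k" if "0 < n" "n < 2 ^ k" for n :: nat
  proof -
    have "2 ^ multiplicity 2 n \<le> n" using that by (intro dvd_imp_le multiplicity_dvd)
    also note \<open>n < 2 ^ k\<close>
    finally show ?thesis by simp
  qed
  then show ?thesis by (auto simp: partial_word_def hole_zimin_def)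
qed

lemma hole_zimin_squares:
  assumes k: "1 \<le> k"
  shows "\<exists>!i. starts_square {..<k} (hole_zimin k) i"
    and "card (squares {..<k} (hole_zimin k)) = k"
proof -
  have ne: "{..<k} \<noteq> {}" using k by (auto simp: lessThan_empty_iff)
  note pw = partial_word_hole_zimin[of k]
  show ex1: "\<exists>!i. starts_square {..<k} (hole_zimin k) i"
    \<comment> \<open>Existence comes from period 1, available since
      \<open>1 \<le> k\<close>.\<close>
    unfolding starts_square_iff[OF pw ne]
    using square_at_hole_zimin[of 0 k] square_at_hole_zimin_start k
    by (metis less_eq_Suc_le One_nat_def)
  \<comment> \<open>Only \<open>k\<close> squares are exhibited; that there are no others follows
    from the upper bound.\<close>
  have "(\<lambda>j. (Suc 0, 0 + 2 * 2 ^ j)) ` {..<k} \<subseteq> squares {..<k} (hole_zimin k)"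
    unfolding squares_eq[OF pw ne] using square_at_hole_zimin by fastforce
  moreover have "inj_on (\<lambda>j::nat. (Suc 0, 0 + 2 * 2 ^ j :: nat)) {..<k}"
    by (auto simp: inj_on_def)
  ultimately have "card {..<k} \<le> card (squares {..<k} (hole_zimin k))"
    using finite_squares by (metis card_inj_on_le)
  then show "card (squares {..<k} (hole_zimin k)) = k"
    using card_squares_le[OF _ pw ex1] by simp
qed

theorem theorem6:
  "(\<forall>(k::nat) (\<Sigma>::'a set) (w::'a pword).
      finite \<Sigma> \<and> card \<Sigma> = k \<and> partial_word \<Sigma> w \<and> (\<exists>!i. starts_square \<Sigma> w i)
        \<longrightarrow> card (squares \<Sigma> w) \<le> k)
   \<and> (\<forall>k::nat. k \<ge> 1 \<longrightarrow>
        (\<exists>(\<Sigma>::nat set) (w::nat pword).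
           finite \<Sigma> \<and> card \<Sigma> = k \<and> partial_word \<Sigma> w \<and> (\<exists>!i. starts_square \<Sigma> w i)
             \<and> card (squares \<Sigma> w) = k))"
proof (intro conjI allI impI)
  fix k :: nat and \<Sigma> :: "'a set" and w :: "'a pword"
  assume "finite \<Sigma> \<and> card \<Sigma> = k \<and> partial_word \<Sigma> w \<and> (\<exists>!i. starts_square \<Sigma> w i)"
  then show "card (squares \<Sigma> w) \<le> k" using card_squares_le by blast
next
  fix k :: nat
  assume "1 \<le> k"
  then have "finite {..<k} \<and> card {..<k} = k \<and> partial_word {..<k} (hole_zimin k)
      \<and> (\<exists>!i. starts_square {..<k} (hole_zimin k) i)
      \<and> card (squares {..<k} (hole_zimin k)) = k"
    by (intro conjI finite_lessThan card_lessThan partial_word_hole_zimin hole_zimin_squares)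
  then show "\<exists>(\<Sigma>::nat set) w. finite \<Sigma> \<and> card \<Sigma> = k \<and> partial_word \<Sigma> w
      \<and> (\<exists>!i. starts_square \<Sigma> w i) \<and> card (squares \<Sigma> w) = k"
    by blast
qed

end
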